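(* For every integer $n \geq 3$, the chromatic number of the cubical staircase graph $CS_n$ is $$\chi(CS_n) = \begin{cases} 1, & n = 3,\\ 2, & n \geq 4.\end{cases}$$
   Context: For a natural number $n \geq 3$, the cubical staircase graph $CS_n$ is the graph with vertex set $\{(i,j,k) : 1 \leq i \leq n-2,\ 1 \leq j \leq i,\ 1 \leq k \leq n-1-i\}$ and edge set consisting of the pairs $(i,j,k)(i,j,k+1)$ for $1\le i\le n-2$, $1\le j\le i$, $1\le k\le n-2-i$; the pairs $(i,j,k)(i+1,j,k)$ for $1\le i\le n-3$, $1\le j\le i$, $1\le k\le n-1-i$; and the pairs $(i,j,k)(i,j+1,k)$ for $1\le i\le n-2$, $1\le j\le i-1$, $1\le k\le n-1-i$ (only pairs of vertices of $CS_n$ are included). *)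

theory Defs
  imports Main
begin

text \<open>A finite simple graph is a pair of a vertex set and a set of edges, an edge being a
  two-element set of vertices.\<close>

type_synonym 'a graph = "'a set \<times> 'a set set"

definition verts :: "'a graph \<Rightarrow> 'a set" where
  "verts G = fst G"

definition edges :: "'a graph \<Rightarrow> 'a set set" where
  "edges G = snd G"

definition simple_graph :: "'a graph \<Rightarrow> bool" where
  "simple_graph G \<longleftrightarrow> finite (verts G) \<and> (\<forall>e\<in>edges G. e \<subseteq> verts G \<and> card e = 2)"

definition proper_colouring :: "'a graph \<Rightarrow> nat \<Rightarrow> ('a \<Rightarrow> nat) \<Rightarrow> bool" where
  "proper_colouring G k c \<longleftrightarrow>
     (\<forall>v\<in>verts G. c v < k) \<and> (\<forall>u v. {u, v} \<in> edges G \<longrightarrow> c u \<noteq> c v)"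

text \<open>On a finite simple graph some proper colouring exists (colour the vertices injectively),
  so the minimum below is attained.\<close>

definition chromatic_number :: "'a graph \<Rightarrow> nat" where
  "chromatic_number G = (LEAST k. \<exists>c. proper_colouring G k c)"

text \<open>All subtractions below are evaluated on natural numbers under bounds on \<open>i\<close> and \<open>n \<ge> 3\<close>
  that keep them from being truncated.\<close>

definition CS_verts :: "nat \<Rightarrow> (nat \<times> nat \<times> nat) set" where
  "CS_verts n = {(i, j, k) | i j k.
     1 \<le> i \<and> i \<le> n - 2 \<and> 1 \<le> j \<and> j \<le> i \<and> 1 \<le> k \<and> k \<le> n - 1 - i}"

text \<open>The intersection with \<open>Pow (CS_verts n)\<close> matters for the second family: at \<open>k = n - 1 - i\<close>
  the triple \<open>(i + 1, j, k)\<close> is not a vertex.\<close>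

definition CS_edges :: "nat \<Rightarrow> (nat \<times> nat \<times> nat) set set" where
  "CS_edges n =
     ({{(i, j, k), (i, j, k + 1)} | i j k.
         1 \<le> i \<and> i \<le> n - 2 \<and> 1 \<le> j \<and> j \<le> i \<and> 1 \<le> k \<and> k \<le> n - 2 - i} \<union>
      {{(i, j, k), (i + 1, j, k)} | i j k.
         1 \<le> i \<and> i \<le> n - 3 \<and> 1 \<le> j \<and> j \<le> i \<and> 1 \<le> k \<and> k \<le> n - 1 - i} \<union>
      {{(i, j, k), (i, j + 1, k)} | i j k.
         1 \<le> i \<and> i \<le> n - 2 \<and> 1 \<le> j \<and> j \<le> i - 1 \<and> 1 \<le> k \<and> k \<le> n - 1 - i})
     \<inter> Pow (CS_verts n)"

definition CS :: "nat \<Rightarrow> (nat \<times> nat \<times> nat) graph" where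
  "CS n = (CS_verts n, CS_edges n)"

lemma simple_graph_CS: "simple_graph (CS n)"
proof -
  have "CS_verts n \<subseteq> {..n} \<times> {..n} \<times> {..n}"
    by (auto simp: CS_verts_def)
  then have "finite (CS_verts n)"
    by (rule finite_subset) auto
  moreover have "card e = 2" if "e \<in> CS_edges n" for e
    using that unfolding CS_edges_def by auto
  ultimately show ?thesis
    unfolding simple_graph_def CS_def verts_def edges_def by (auto simp: CS_edges_def)
qed

lemma simple_graph_colourable:
  assumes "simple_graph G"
  shows "\<exists>c. proper_colouring G (card (verts G)) c"
proof -
  obtain c where c: "bij_betw c (verts G) {0..<card (verts G)}"
    using assms ex_bij_betw_finite_nat unfolding simple_graph_def by blast
  have "c u \<noteq> c v" if "{u, v} \<in> edges G" for u v
  proof -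
    have uv: "{u, v} \<subseteq> verts G" "card {u, v} = 2"
      using that assms unfolding simple_graph_def by blast+
    then have "u \<noteq> v" by auto
    then show ?thesis
      using uv(1) c by (auto simp: bij_betw_def inj_on_def)
  qed
  moreover have "c v < card (verts G)" if "v \<in> verts G" for v
    using bij_betwE[OF c] that by auto
  ultimately show ?thesis
    unfolding proper_colouring_def by blast
qed

end

theory Submission
  imports Defs
begin

text \<open>Every edge joins triples whose coordinate sums differ by one, so \<open>CS n\<close> is
  bipartite and two colours suffice (\<open>proper_colouring_CS\<close>). For n = 3 the graph is a
  single isolated vertex, where one colour is enough and, there being a vertex, necessary. For n
  \<ge> 4 there is an edge, whose endpoints force two colours
  (\<open>proper_colouring_edge\<close>).\<close>

lemma chromatic_number_eqI:
  assumes "proper_colouring G k c"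
    and "\<And>l c'. proper_colouring G l c' \<Longrightarrow> k \<le> l"
  shows "chromatic_number G = k"
  unfolding chromatic_number_def using assms by (blast intro: Least_equality)

lemma proper_colouring_nonempty:
  assumes "proper_colouring G k c" "verts G \<noteq> {}"
  shows "1 \<le> k"
  using assms by (force simp: proper_colouring_def)

lemma proper_colouring_edge:
  assumes "proper_colouring G k c" "{u, v} \<in> edges G" "u \<in> verts G" "v \<in> verts G"
  shows "2 \<le> k"
proof -
  have "c u < k" "c v < k" "c u \<noteq> c v"
    using assms by (auto simp: proper_colouring_def)
  then show ?thesis by linarith
qed

text \<open>Each edge changes exactly one coordinate by one, so the parity of the coordinate sum
  is a bipartition.\<close>

lemma proper_colouring_CS: "proper_colouring (CS n) 2 (\<lambda>(i, j, k). (i + j + k) mod 2)"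
  unfolding proper_colouring_def
proof (intro conjI ballI allI impI)
  fix u v :: "nat \<times> nat \<times> nat"
  assume "{u, v} \<in> edges (CS n)"
  then show "(case u of (i, j, k) \<Rightarrow> (i + j + k) mod 2) \<noteq> (case v of (i, j, k) \<Rightarrow> (i + j + k) mod 2)"
    by (auto simp: CS_def edges_def CS_edges_def doubleton_eq_iff mod_Suc split: if_splits)
qed auto

text \<open>At \<open>n = 3\<close> each family has an empty range: the bounds leave
  \<open>k \<le> 0\<close> in the first, \<open>i \<le> 0\<close> in the second and
  \<open>j \<le> 0\<close> in the third.\<close>

lemma edges_CS_3: "edges (CS 3) = {}"
  by (auto simp: CS_def edges_def CS_edges_def)

theorem theorem3:
  fixes n :: nat
  assumes "n \<ge> 3"
  shows "chromatic_number (CS n) = (if n = 3 then 1 else 2)"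
proof (cases "n = 3")
  case True
  have "proper_colouring (CS 3) 1 (\<lambda>_. 0)"
    by (simp add: proper_colouring_def edges_CS_3)
  moreover have "(1, 1, 1) \<in> verts (CS 3)"
    by (simp add: CS_def verts_def CS_verts_def)
  ultimately have "chromatic_number (CS 3) = 1"
    by (intro chromatic_number_eqI) (auto dest: proper_colouring_nonempty)
  with True show ?thesis by simp
next
  case False
  with assms have "n \<ge> 4" by simp
  \<comment> \<open>At \<open>i = 1\<close> the bound on \<open>k\<close> is \<open>n - 2\<close>,
    so \<open>k = 2\<close> is allowed exactly from n = 4 on.\<close>
  then have verts: "(1, 1, 1) \<in> verts (CS n)" "(1, 1, 2) \<in> verts (CS n)"
    by (auto simp: CS_def verts_def CS_verts_def)
  have "{(1, 1, 1), (1, 1, 2)} \<in> edges (CS n)"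
    unfolding CS_def edges_def CS_edges_def snd_conv
  proof (intro IntI UnI1 CollectI exI conjI)
    \<comment> \<open>Writing 2 as \<open>1 + 1\<close> matches the shape \<open>k + 1\<close> of
      the first edge family, so unification fixes the witnesses
      \<open>i = j = k = 1\<close>.\<close>
    show "{(1, 1, 1), (1, 1, 2)} = {(1, 1, 1), (1, 1, 1 + 1 :: nat)}" by (simp only: one_add_one)
    show "{(1, 1, 1), (1, 1, 2)} \<in> Pow (CS_verts n)"
      using verts by (simp add: CS_def verts_def)
  qed (use \<open>n \<ge> 4\<close> in auto)
  then have "chromatic_number (CS n) = 2"
    using verts by (intro chromatic_number_eqI[OF proper_colouring_CS]) (rule proper_colouring_edge)
  with False show ?thesis by simp
qed

end
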